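(* Let $v>w\ge 0$ be integers. Then $$wavecost\ \mathscr{MON}(v+w,v;4,1)=\binom{v}{2}.$$
   Context: Let $n\ge v\ge 0$ and let $C>C'\ge 1$ be integers. Let $X$ be a set of $n$ vertices, $K_n$ the complete graph on $X$, and $V\subseteq X$ a fixed subset with $|V|=v$; write $w=n-v$. A grooming $N(n,v;C,C')$ is a partition of the edge set $E(K_n)$ into (nonempty, not necessarily connected) subgraphs $B_1,\dots,B_\Lambda$ of $K_n$, without isolated vertices, such that for all $k$, $|E(B_k)|\le C$ and $B_k$ contains at most $C'$ edges having both ends in $V$. The (drop) cost of a grooming is $\sum_{k=1}^{\Lambda}|V(B_k)|$, and its number of wavelengths (wavecost) is $\Lambda$. $\mathscr{ON}(n,v;C,C')$ denotes a grooming $N(n,v;C,C')$ of minimum cost. $\mathscr{MON}(n,v;C,C')$ denotes one whose number of wavelengths is minimum among all $\mathscr{ON}(n,v;C,C')$, i.e. among minimum-cost groomings only, and $wavecost\ \mathscr{MON}(n,v;C,C')$ denotes that minimum number of wavelengths. *)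

theory Defs
  imports Main "HOL-Library.Disjoint_Sets"
begin

definition complete_edges :: "'a set \<Rightarrow> 'a set set" where
  "complete_edges X = {e. e \<subseteq> X \<and> card e = 2}"

text \<open>
  A subgraph without isolated vertices is determined by its edge set, so each \<open>B\<^sub>k\<close> is
  represented by its edge set \<open>B\<close>; its vertex set is then \<open>\<Union>B\<close>. A grooming is the set
  \<open>P\<close> of these edge sets. Since they are nonempty and pairwise disjoint, \<open>card P\<close> is the
  number of wavelengths.
\<close>

definition grooming :: "'a set \<Rightarrow> 'a set \<Rightarrow> nat \<Rightarrow> nat \<Rightarrow> 'a set set set \<Rightarrow> bool" where
  "grooming X V C C' P \<longleftrightarrow>
     partition_on (complete_edges X) P \<and>
     (\<forall>B\<in>P. card B \<le> C \<and> card {e \<in> B. e \<subseteq> V} \<le> C')"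

definition cost :: "'a set set set \<Rightarrow> nat" where
  "cost P = (\<Sum>B\<in>P. card (\<Union>B))"

definition ON :: "'a set \<Rightarrow> 'a set \<Rightarrow> nat \<Rightarrow> nat \<Rightarrow> 'a set set set \<Rightarrow> bool" where
  "ON X V C C' P \<longleftrightarrow>
     grooming X V C C' P \<and> (\<forall>Q. grooming X V C C' Q \<longrightarrow> cost P \<le> cost Q)"

definition MON :: "'a set \<Rightarrow> 'a set \<Rightarrow> nat \<Rightarrow> nat \<Rightarrow> 'a set set set \<Rightarrow> bool" where
  "MON X V C C' P \<longleftrightarrow>
     ON X V C C' P \<and> (\<forall>Q. ON X V C C' Q \<longrightarrow> card P \<le> card Q)"

definition wavecost_MON :: "'a set \<Rightarrow> 'a set \<Rightarrow> nat \<Rightarrow> nat \<Rightarrow> nat" where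
  "wavecost_MON X V C C' = (LEAST l. \<exists>P. ON X V C C' P \<and> card P = l)"

lemma grooming_singletons:
  assumes "C \<ge> 1" "C' \<ge> 1"
  shows "grooming X V C C' ((\<lambda>e. {e}) ` complete_edges X)"
proof -
  have "card {e \<in> {e'}. e \<subseteq> V} \<le> C'" for e'
    by (rule order.trans[OF card_mono[of "{e'}"]]) (use assms(2) in auto)
  moreover have "partition_on (complete_edges X) ((\<lambda>e. {e}) ` complete_edges X)"
    by (auto simp: partition_on_def disjoint_def)
  ultimately show ?thesis
    using assms(1) by (simp add: grooming_def)
qed

text \<open>The minimum in the definition of \<^const>\<open>wavecost_MON\<close> is never taken over an empty set.\<close>

lemma ON_exists:
  assumes "C \<ge> 1" "C' \<ge> 1"
  shows "\<exists>P. ON X V C C' P"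
  using ex_has_least_nat[of "grooming X V C C'" _ cost, OF grooming_singletons[OF assms]]
  unfolding ON_def by blast

lemma MON_exists:
  assumes "C \<ge> 1" "C' \<ge> 1"
  shows "\<exists>P. MON X V C C' P"
proof -
  obtain P where "ON X V C C' P"
    using ON_exists[OF assms] by blast
  from ex_has_least_nat[of "ON X V C C'" P card, OF this] show ?thesis
    unfolding MON_def by blast
qed

lemma card_MON:
  assumes "MON X V C C' P"
  shows "card P = wavecost_MON X V C C'"
  unfolding wavecost_MON_def
  by (rule Least_equality[symmetric]) (use assms in \<open>auto simp: MON_def\<close>)

end

theory Submission
  imports Defs
begin

text \<open>
  Every block contains at most one edge inside \<open>V\<close>, so every grooming has at least
  \<open>v choose 2\<close> blocks. A block with at most four edges has at least as many vertices as edges,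
  and at least one more if it contains an edge inside \<open>V\<close> but at most one cross edge; since there
  are \<open>v * w\<close> cross edges, the cost is at least
  \<open>(v + w choose 2) + (v choose 2) - v * w div 2\<close>.

  Both bounds are attained by the same grooming. Identify \<open>V\<close> with the integers modulo
  \<open>u = 2 * h + 1\<close>, plus one extra point \<open>z\<close> if \<open>v\<close> is even, and the rest of \<open>X\<close> with a set \<open>S\<close> of
  residues. For \<open>1 \<le> d \<le> h\<close>, the edge \<open>{a + d, a - d}\<close> of \<open>V\<close> spans a triangle with the outer
  vertex \<open>a\<close>, to which the outer edge \<open>{a, a + d}\<close> is appended. The cross edges between
  equal residues remain: for even \<open>v\<close> they form triangles with the edges \<open>{a, z}\<close>; for
  odd \<open>v\<close> choose \<open>S\<close> almost symmetric and without \<open>0\<close>, so that they form 4-cycles through the edges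
  \<open>{d, -d}\<close> of \<open>V\<close> and \<open>{d, -d}\<close> of \<open>S\<close>.
\<close>

section \<open>Edge counts and groomings obtained from covers\<close>

lemma card_complete_edges: "finite X \<Longrightarrow> card (complete_edges X) = card X choose 2"
  unfolding complete_edges_def by (rule n_subsets)

lemma finite_complete_edges: "finite X \<Longrightarrow> finite (complete_edges X)"
  unfolding complete_edges_def by (rule finite_subset[of _ "Pow X"]) auto

lemma choose_two_add: "(m + n) choose 2 = (m choose 2) + (n choose 2) + m * n"
  by (induction n) (auto simp: numeral_2_eq_2)

lemma complete_edgesE:
  assumes "e \<in> complete_edges X"
  obtains r s where "e = {r, s}" "r \<noteq> s" "r \<in> X" "s \<in> X"
  using assms unfolding complete_edges_def card_2_iff by auto

text \<open>
  The \<open>B i\<close> may overlap: assigning each edge to one of the blocks covering it only shrinks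
  the blocks, hence does not increase the cost.
\<close>

lemma grooming_of_cover:
  assumes "finite I" and cover: "complete_edges X \<subseteq> (\<Union>i\<in>I. B i)"
    and B: "\<And>i. i \<in> I \<Longrightarrow> finite (B i)" "\<And>i. i \<in> I \<Longrightarrow> card (B i) \<le> C"
      "\<And>i. i \<in> I \<Longrightarrow> card {e \<in> B i. e \<subseteq> V} \<le> C'"
    and U: "\<And>i. i \<in> I \<Longrightarrow> \<Union>(B i) \<subseteq> U i" "\<And>i. i \<in> I \<Longrightarrow> finite (U i)"
  obtains P where "grooming X V C C' P" "card P \<le> card I" "cost P \<le> (\<Sum>i\<in>I. card (U i))"
proof -
  from cover have "\<forall>e\<in>complete_edges X. \<exists>i. i \<in> I \<and> e \<in> B i"
    by blast
  then obtain f where f: "\<And>e. e \<in> complete_edges X \<Longrightarrow> f e \<in> I \<and> e \<in> B (f e)"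
    by metis
  define F where "F i = {e \<in> complete_edges X. f e = i}" for i
  have F_sub: "F i \<subseteq> B i" for i
    using f by (auto simp: F_def)
  \<comment> \<open>Empty classes are dropped because a partition has no empty part. They contribute
    0 to the cost, so sums over all of \<open>I\<close> still bound it.\<close>
  define P where "P = F ` I - {{}}"
  have "partition_on (complete_edges X) P"
    unfolding partition_on_def disjoint_def using f by (auto simp: P_def F_def)
  moreover have "card (F i) \<le> C" "card {e \<in> F i. e \<subseteq> V} \<le> C'" if "i \<in> I" for i
  proof -
    show "card (F i) \<le> C"
      using card_mono[OF B(1)[OF that] F_sub] B(2)[OF that] by linarith
    have "card {e \<in> F i. e \<subseteq> V} \<le> card {e \<in> B i. e \<subseteq> V}"
      by (rule card_mono) (use B(1)[OF that] F_sub in auto)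
    then show "card {e \<in> F i. e \<subseteq> V} \<le> C'"
      using B(3)[OF that] by linarith
  qed
  ultimately have "grooming X V C C' P"
    unfolding grooming_def by (auto simp: P_def)
  moreover have "card P \<le> card I"
    using card_mono[of "F ` I" P] card_image_le[of I F] \<open>finite I\<close> by (auto simp: P_def)
  moreover have "cost P \<le> (\<Sum>i\<in>I. card (U i))"
  proof -
    have "cost P \<le> (\<Sum>B\<in>F ` I. card (\<Union>B))"
      unfolding cost_def P_def by (rule sum_mono2) (use \<open>finite I\<close> in auto)
    also have "\<dots> \<le> (\<Sum>i\<in>I. card (\<Union>(F i)))"
      using sum_image_le[OF \<open>finite I\<close>, of "\<lambda>B. card (\<Union>B)" F] by (simp add: o_def)
    also have "\<dots> \<le> (\<Sum>i\<in>I. card (U i))"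
      by (rule sum_mono, rule card_mono) (use U F_sub in blast)+
    finally show ?thesis .
  qed
  ultimately show ?thesis
    by (rule that)
qed

section \<open>Lower bounds on wavelengths and cost\<close>

lemma choose_two_le: "n \<le> 3 \<Longrightarrow> n choose 2 \<le> n" for n :: nat
  by (auto simp: numeral_3_eq_3 numeral_2_eq_2 le_Suc_eq)

text \<open>With at most four edges, a block has no more edges than vertices: up to three vertices
  span at most that many edges, and four vertices match the bound. An edge inside \<open>V\<close>
  adds one on the left, which either two cross edges or an additional vertex compensate.\<close>

lemma card_block_le:
  assumes "finite X" "B \<subseteq> complete_edges X" "card B \<le> 4" "card {e \<in> B. e \<subseteq> V} \<le> 1"
  shows "card B + card {e \<in> B. e \<subseteq> V} \<le> card (\<Union>B) + card {e \<in> B. \<not> e \<subseteq> V \<and> \<not> e \<subseteq> X - V} div 2"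
proof -
  have "\<Union>B \<subseteq> X"
    using assms(2) by (auto simp: complete_edges_def)
  then have fin: "finite (\<Union>B)"
    using assms(1) finite_subset by blast
  have sub: "B \<subseteq> complete_edges (\<Union>B)"
    using assms(2) by (auto simp: complete_edges_def)
  have finB: "finite B"
    using sub finite_complete_edges[OF fin] finite_subset by blast
  have "card B \<le> card (\<Union>B) choose 2"
    using card_mono[OF finite_complete_edges[OF fin] sub] card_complete_edges[OF fin] by simp
  then have ge: "card B \<le> card (\<Union>B)"
    using choose_two_le[of "card (\<Union>B)"] assms(3) by linarith
  define c where "c = card {e \<in> B. \<not> e \<subseteq> V \<and> \<not> e \<subseteq> X - V}"
  \<comment> \<open>Without an edge inside \<open>V\<close>, \<open>ge\<close> suffices; with at
    least two cross edges, \<open>c div 2\<close> pays for that edge. Otherwise a vertex in excess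
    of the edges must be found.\<close>
  show ?thesis
  proof (cases "card {e \<in> B. e \<subseteq> V} = 0 \<or> c \<ge> 2")
    case True
    then have "card {e \<in> B. e \<subseteq> V} \<le> c div 2"
      using assms(4) by auto
    then show ?thesis
      using ge unfolding c_def by linarith
  next
    case False
    then have one: "card {e \<in> B. e \<subseteq> V} = 1" and c: "c \<le> 1"
      using assms(4) by auto
    then obtain e where e: "e \<in> B" "e \<subseteq> V"
      by (metis (mono_tags, lifting) card_1_singletonE insertI1 mem_Collect_eq)
    have "card e = 2"
      using e assms(2) by (auto simp: complete_edges_def)
    \<comment> \<open>The ends of \<open>e\<close> lie in \<open>V\<close>, so the \<open>m\<close>
      vertices outside \<open>V\<close> come on top of them.\<close>
    define m where "m = card (\<Union>B - V)"
    have "card (e \<union> (\<Union>B - V)) \<le> card (\<Union>B)"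
      using e by (intro card_mono fin) auto
    moreover have "card (e \<union> (\<Union>B - V)) = 2 + m"
      unfolding m_def using e fin \<open>card e = 2\<close>
      by (subst card_Un_disjoint) (auto intro: card_ge_0_finite)
    ultimately have n: "2 + m \<le> card (\<Union>B)"
      by linarith
    define D where "D = {e \<in> B. e \<subseteq> X - V}"
    have "D \<subseteq> complete_edges (\<Union>B - V)"
      using assms(2) by (auto simp: complete_edges_def D_def)
    then have D: "card D \<le> m choose 2"
      using card_mono[OF finite_complete_edges[of "\<Union>B - V"]] card_complete_edges[of "\<Union>B - V"] fin
      by (simp add: m_def)
    have "B = {e \<in> B. e \<subseteq> V} \<union> {e \<in> B. \<not> e \<subseteq> V \<and> \<not> e \<subseteq> X - V} \<union> D"
      by (auto simp: D_def)
    then have "card B \<le> card {e \<in> B. e \<subseteq> V} + c + card D"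
      unfolding c_def by (metis (no_types, lifting) card_Un_le add_le_mono1 order_trans)
    then have cB: "card B \<le> 1 + c + (m choose 2)"
      using one D by linarith
    have "c = 0" if "m = 0"
    proof -
      have "\<Union>B \<subseteq> V"
        using that fin by (simp add: m_def)
      then have "{e \<in> B. \<not> e \<subseteq> V \<and> \<not> e \<subseteq> X - V} = {}"
        by blast
      then show ?thesis
        by (simp only: c_def card.empty)
    qed
    \<comment> \<open>For \<open>m\<close> = 0, 1, 2 there are at most 1, 2, 3 edges and at least 2,
      3, 4 vertices; for larger \<open>m\<close>, at least 5 vertices face at most 4 edges.\<close>
    moreover have "m = 0 \<or> m = 1 \<or> m = 2 \<or> m \<ge> 3"
      by linarith
    ultimately have "card B + 1 \<le> card (\<Union>B)"
      using cB c n assms(3) by (auto simp: numeral_2_eq_2)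
    then show ?thesis
      using one by linarith
  qed
qed

text \<open>Distinct edges inside \<open>V\<close> need distinct blocks. For the cost,
  \<open>card_block_le\<close> is summed over the blocks; as they partition the edges, the local
  counts add up to global ones.\<close>

lemma grooming_lower_bounds:
  assumes "finite X" "V \<subseteq> X" "grooming X V 4 1 P"
  shows "card V choose 2 \<le> card P"
    and "(card X choose 2) + (card V choose 2) \<le> cost P + card V * card (X - V) div 2"
proof -
  let ?E = "complete_edges X"
  have P: "partition_on ?E P" and blk: "\<And>B. B \<in> P \<Longrightarrow> card B \<le> 4 \<and> card {e \<in> B. e \<subseteq> V} \<le> 1"
    using assms(3) by (auto simp: grooming_def)
  have finE: "finite ?E"
    by (rule finite_complete_edges[OF assms(1)])
  have finP: "finite P"
    using P finE finite_elements by blast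
  have sub: "B \<subseteq> ?E" if "B \<in> P" for B
    using P that by (auto simp: partition_on_def)
  have finB: "finite B" if "B \<in> P" for B
    using sub[OF that] finE finite_subset by blast
  have disj: "B \<inter> B' = {}" if "B \<in> P" "B' \<in> P" "B \<noteq> B'" for B B'
    using P that by (auto simp: partition_on_def disjoint_def)
  have split: "card {e \<in> ?E. Q e} = (\<Sum>B\<in>P. card {e \<in> B. Q e})" for Q
  proof -
    have "{e \<in> ?E. Q e} = (\<Union>B\<in>P. {e \<in> B. Q e})"
      using P by (auto simp: partition_on_def)
    moreover have "card (\<Union>B\<in>P. {e \<in> B. Q e}) = (\<Sum>B\<in>P. card {e \<in> B. Q e})"
      by (rule card_UN_disjoint[OF finP]) (use finB disj in fastforce)+
    ultimately show ?thesis by simp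
  qed
  have finV: "finite V"
    using assms finite_subset by blast
  have EV: "{e \<in> ?E. e \<subseteq> V} = complete_edges V"
    using assms(2) by (auto simp: complete_edges_def)
  have V: "(\<Sum>B\<in>P. card {e \<in> B. e \<subseteq> V}) = card V choose 2"
    unfolding split[symmetric] EV by (rule card_complete_edges[OF finV])
  have "(\<Sum>B\<in>P. card {e \<in> B. e \<subseteq> V}) \<le> (\<Sum>B\<in>P. 1)"
    by (rule sum_mono) (use blk in blast)
  then show "card V choose 2 \<le> card P"
    using V by simp
  let ?c = "\<lambda>e. \<not> e \<subseteq> V \<and> \<not> e \<subseteq> X - V"
  have EW: "{e \<in> ?E. e \<subseteq> X - V} = complete_edges (X - V)"
    by (auto simp: complete_edges_def)
  \<comment> \<open>The cross edges are counted by subtraction: all edges minus those inside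
    \<open>V\<close> and those inside \<open>X - V\<close>.\<close>
  have "?E = (complete_edges V \<union> complete_edges (X - V)) \<union> {e \<in> ?E. ?c e}"
    using EV EW by blast
  also have "card \<dots> = card (complete_edges V) + card (complete_edges (X - V)) + card {e \<in> ?E. ?c e}"
  proof -
    have "complete_edges V \<inter> complete_edges (X - V) = {}"
      by (fastforce simp: complete_edges_def card_2_iff)
    moreover have "(complete_edges V \<union> complete_edges (X - V)) \<inter> {e \<in> ?E. ?c e} = {}"
      using EV EW by blast
    ultimately show ?thesis
      using finE assms(1) finV by (simp add: card_Un_disjoint finite_complete_edges)
  qed
  finally have "card X choose 2 = (card V choose 2) + (card (X - V) choose 2) + card {e \<in> ?E. ?c e}"
    using assms(1) finV by (simp add: card_complete_edges)
  moreover have "card X = card V + card (X - V)"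
    using assms(1,2) by (simp add: card_Diff_subset card_mono finV)
  ultimately have cross: "card {e \<in> ?E. ?c e} = card V * card (X - V)"
    using choose_two_add[of "card V" "card (X - V)"] by simp
  have "(card X choose 2) + (card V choose 2) = (\<Sum>B\<in>P. card B + card {e \<in> B. e \<subseteq> V})"
    using split[of "\<lambda>_. True"] V card_complete_edges[OF assms(1)] by (simp add: sum.distrib)
  also have "\<dots> \<le> (\<Sum>B\<in>P. card (\<Union>B) + card {e \<in> B. ?c e} div 2)"
    by (rule sum_mono) (use card_block_le[OF assms(1) sub] blk in blast)
  also have "\<dots> = cost P + (\<Sum>B\<in>P. card {e \<in> B. ?c e} div 2)"
    by (simp add: sum.distrib cost_def)
  \<comment> \<open>Rounding down block by block loses at least as much as rounding down the total
    once.\<close>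
  also have "(\<Sum>B\<in>P. card {e \<in> B. ?c e} div 2) \<le> card V * card (X - V) div 2"
  proof -
    have "2 * (\<Sum>B\<in>P. card {e \<in> B. ?c e} div 2) \<le> (\<Sum>B\<in>P. card {e \<in> B. ?c e})"
      unfolding sum_distrib_left by (rule sum_mono) simp
    then show ?thesis
      using cross split[of ?c] by linarith
  qed
  finally show "(card X choose 2) + (card V choose 2) \<le> cost P + card V * card (X - V) div 2"
    by linarith
qed

section \<open>Midpoints and differences modulo \<open>2 * h + 1\<close>\<close>

text \<open>Since \<open>u\<close> is odd, 2 is invertible modulo \<open>u\<close>, so every pair
  has a midpoint \<open>a\<close>; the half-difference can be taken in \<open>1..h\<close> up to
  sign. Thus every pair of residues is met by some index \<open>(a, d)\<close>.\<close>

lemma ex_midpoint: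
  fixes x y u :: int
  assumes "u = 2 * int h + 1" "x \<in> {0..<u}" "y \<in> {0..<u}" "x \<noteq> y"
  obtains a d where "a \<in> {0..<u}" "d \<in> {1..int h}" "{(a + d) mod u, (a - d) mod u} = {x, y}"
proof -
  have "\<exists>a\<in>{0..<u}. \<exists>d\<in>{1..int h}. {(a + d) mod u, (a - d) mod u} = {x, y}"
    if "x < y" "x \<in> {0..<u}" "y \<in> {0..<u}" for x y
  proof (cases "even (y - x)")
    case True
    then obtain d where d: "y = x + 2 * d"
      by (metis add.commute diff_add_cancel evenE)
    have "{(x + d + d) mod u, (x + d - d) mod u} = {x, y}"
      using that d by (simp add: insert_commute add.commute)
    moreover have "x + d \<in> {0..<u}" "d \<in> {1..int h}"
      using that d unfolding atLeastLessThan_iff atLeastAtMost_iff assms(1) by linarith+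
    ultimately show ?thesis
      by blast
  next
    case False
    \<comment> \<open>The two arcs between \<open>x\<close> and \<open>y\<close> have lengths of
      opposite parity, so the midpoint is taken on the arc through 0, starting from
      \<open>y\<close>.\<close>
    then have "even (u - (y - x))"
      using assms(1) by simp
    then obtain d where d: "u - (y - x) = 2 * d"
      by (rule evenE)
    have e: "y + d + d = x + u"
      using d by linarith
    have "((y + d) mod u + d) mod u = (x + u) mod u"
      unfolding mod_add_left_eq e ..
    also have "\<dots> = x"
      using that by simp
    finally have "((y + d) mod u + d) mod u = x" .
    moreover have "((y + d) mod u - d) mod u = y"
      unfolding mod_diff_left_eq using that by simp
    ultimately have "{((y + d) mod u + d) mod u, ((y + d) mod u - d) mod u} = {x, y}"
      by simp
    moreover have "d \<in> {1..int h}"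
      using that d unfolding atLeastLessThan_iff atLeastAtMost_iff assms(1) by linarith
    moreover have "(y + d) mod u \<in> {0..<u}"
      using that by simp
    ultimately show ?thesis
      by blast
  qed
  from this[of x y] this[of y x] show ?thesis
    using assms that by (metis insert_commute linorder_neqE)
qed

text \<open>One of the two differences \<open>x - a\<close> and \<open>a - x\<close> has its residue
  in \<open>1..h\<close>. The reverse equation for \<open>a\<close> is kept so that either point can
  serve as the starting point.\<close>

lemma ex_mod_diff:
  fixes x a u :: int
  assumes "u = 2 * int h + 1" "x \<in> {0..<u}" "a \<in> {0..<u}" "x \<noteq> a"
  obtains d where "d \<in> {1..int h}" "x = (a + d) mod u \<and> a = (x - d) mod u \<or> x = (a - d) mod u \<and> a = (x + d) mod u"
proof -
  have "\<exists>d\<in>{1..int h}. x = (a + d) mod u \<and> a = (x - d) mod u \<or> x = (a - d) mod u \<and> a = (x + d) mod u"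
    if "a < x" "x \<in> {0..<u}" "a \<in> {0..<u}" for x a
  proof (cases "x - a \<le> int h")
    case True
    then show ?thesis
      using that by (intro bexI[of _ "x - a"]) auto
  next
    case False
    define d where "d = u - (x - a)"
    have "a - d = x - u" "x + d = a + u"
      by (simp_all add: d_def)
    moreover have "x = (x - u) mod u" "a = (a + u) mod u"
      using that by simp_all
    ultimately have "x = (a - d) mod u" "a = (x + d) mod u"
      by presburger+
    moreover have "d \<in> {1..int h}"
      using that False unfolding atLeastLessThan_iff atLeastAtMost_iff d_def assms(1) by linarith
    ultimately show ?thesis
      by blast
  qed
  from this[of a x] this[of x a] show ?thesis
    using assms that by (metis linorder_neqE)
qed


lemma mod_add_cancel_bounded:
  fixes a d e u :: int
  assumes "(a + d) mod u = (a + e) mod u" "d \<in> {0..<u}" "e \<in> {0..<u}"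
  shows "d = e"
proof -
  have "d mod u = e mod u"
    using mod_diff_cong[OF assms(1) refl, of a] by simp
  then show ?thesis
    using assms(2,3) by simp
qed

text \<open>Of the two differences of a pair modulo \<^term>\<open>2 * h + 1\<close>, at most one lies in \<open>1, \<dots>, h\<close>.\<close>

lemma two_card_short_le:
  fixes T :: "(int \<times> int) set"
  assumes u: "u = 2 * int h + 1" and T: "T \<subseteq> {0..<u} \<times> {0..<u}" "sym T" "irrefl T"
    and D: "D \<subseteq> {0..int h}"
  shows "2 * card (({0..<u} \<times> D) \<inter> {(a, d). (a, (a + d) mod u) \<in> T}) \<le> card T"
proof -
  define M where "M = ({0..<u} \<times> D) \<inter> {(a, d). (a, (a + d) mod u) \<in> T}"
  define f where "f = (\<lambda>(a, d). (a, (a + d) mod u))"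
  have D_less: "d \<in> {0..<u}" if "d \<in> D" for d
    using that D u by auto
  have "inj_on f M"
  proof (rule inj_onI, clarify)
    fix a d b e assume *: "(a, d) \<in> M" "(b, e) \<in> M" "f (a, d) = f (b, e)"
    then have "a = b" "d \<in> D" "e \<in> D"
      by (simp_all add: f_def M_def)
    moreover have "(a + d) mod u = (a + e) mod u"
      using *(3) by (auto simp: f_def)
    ultimately show "a = b \<and> d = e"
      using mod_add_cancel_bounded[OF _ D_less D_less] by blast
  qed
  then have "card (f ` M) = card M"
    by (rule card_image)
  have finT: "finite T"
    using T(1) finite_subset by blast
  have fM: "f ` M \<subseteq> T"
    by (auto simp: f_def M_def)
  then have sub: "f ` M \<union> (f ` M)\<inverse> \<subseteq> T"
    using T(2) by (auto simp: sym_def)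
  \<comment> \<open>A pair and its reverse would give steps \<open>d\<close> and \<open>e\<close> in
    \<open>0..h\<close> with \<open>d + e\<close> divisible by \<open>u\<close>; as
    \<open>d + e < u\<close>, both vanish and the pair is diagonal, against \<open>irrefl T\<close>.
    Step 0 is allowed because the construction for even \<open>v\<close> uses it.\<close>
  have "f ` M \<inter> (f ` M)\<inverse> = {}"
  proof (rule ccontr)
    assume "f ` M \<inter> (f ` M)\<inverse> \<noteq> {}"
    then obtain a b where ab: "(a, b) \<in> f ` M" "(b, a) \<in> f ` M"
      unfolding ex_in_conv[symmetric] by (metis IntE converseE)
    obtain d where d: "d \<in> D" "b = (a + d) mod u"
      using ab(1) by (auto simp: f_def M_def)
    obtain e where e: "e \<in> D" "a = (b + e) mod u"
      using ab(2) by (auto simp: f_def M_def)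
    have "(a, b) \<in> T"
      using ab(1) fM by blast
    then have "a \<in> {0..<u}" "a \<noteq> b"
      using T(1,3) by (auto simp: irrefl_def)
    have "(a + (d + e)) mod u = (b + e) mod u"
      unfolding d(2) mod_add_left_eq by (simp add: add.assoc)
    also have "\<dots> = (a + 0) mod u"
      using e(2) \<open>a \<in> {0..<u}\<close> by simp
    finally have eq: "(a + (d + e)) mod u = (a + 0) mod u" .
    have "d \<in> {0..int h}" "e \<in> {0..int h}"
      using d(1) e(1) D by blast+
    then have "d + e = 0" "0 \<le> d" "0 \<le> e"
      using u by (auto intro!: mod_add_cancel_bounded[OF eq])
    then have "d = 0"
      by linarith
    then show False
      using d(2) \<open>a \<in> {0..<u}\<close> \<open>a \<noteq> b\<close> by simp
  qed
  moreover have "finite (f ` M)"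
    using fM finT finite_subset by blast
  ultimately have "card (f ` M \<union> (f ` M)\<inverse>) = card M + card M"
    using \<open>card (f ` M) = card M\<close> by (simp add: card_Un_disjoint card_inverse)
  then show ?thesis
    using card_mono[OF finT sub] unfolding M_def by simp
qed

text \<open>Each index pays 2 for the ends of its edge inside \<open>V\<close>, 1 for its outer
  vertex and 1 for its pendant edge. At most half of the pairs of the symmetric \<open>T\<close> are
  reached by a step in \<open>D\<close>, whence \<open>card T div 2\<close>.\<close>

lemma sum_block_sizes_le:
  fixes S :: "int set"
  assumes u: "u = 2 * int h + 1" and T: "T \<subseteq> {0..<u} \<times> {0..<u}" "sym T" "irrefl T"
    and D: "D \<subseteq> {0..int h}" and S: "S \<subseteq> {0..<u}"
  shows "(\<Sum>(a, d)\<in>{0..<u} \<times> D. 2 + of_bool (a \<in> S) + of_bool ((a, (a + d) mod u) \<in> T))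
    \<le> 2 * ((2 * h + 1) * card D) + card S * card D + card T div 2"
proof -
  have fin: "finite ({0..<u} \<times> D)"
    using D finite_subset by auto
  have "(\<Sum>(a, d)\<in>{0..<u} \<times> D. of_bool (a \<in> S)) = card (({0..<u} \<times> D) \<inter> {(a, d). a \<in> S})"
    using fin by (simp add: case_prod_unfold sum_of_bool_eq)
  also have "({0..<u} \<times> D) \<inter> {(a, d). a \<in> S} = S \<times> D"
    using S by auto
  finally have 1: "(\<Sum>(a, d)\<in>{0..<u} \<times> D. of_bool (a \<in> S)) = card S * card D"
    by (simp add: card_cartesian_product)
  have 2: "(\<Sum>(a, d)\<in>{0..<u} \<times> D. of_bool ((a, (a + d) mod u) \<in> T))
      = card (({0..<u} \<times> D) \<inter> {(a, d). (a, (a + d) mod u) \<in> T})"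
    using fin by (simp add: case_prod_unfold sum_of_bool_eq)
  have 3: "(\<Sum>(a, d)\<in>{0..<u} \<times> D. 2) = 2 * ((2 * h + 1) * card D)"
    using u by (simp add: card_cartesian_product case_prod_unfold nat_add_distrib nat_mult_distrib)
  have "(\<Sum>(a, d)\<in>{0..<u} \<times> D. 2 + of_bool (a \<in> S) + of_bool ((a, (a + d) mod u) \<in> T))
      = (\<Sum>(a, d)\<in>{0..<u} \<times> D. 2) + (\<Sum>(a, d)\<in>{0..<u} \<times> D. of_bool (a \<in> S))
        + (\<Sum>(a, d)\<in>{0..<u} \<times> D. of_bool ((a, (a + d) mod u) \<in> T) :: nat)"
    unfolding case_prod_unfold sum.distrib ..
  then show ?thesis
    unfolding 1 2 3 using two_card_short_le[OF u T D] by linarith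
qed

section \<open>Shapes of the blocks\<close>

text \<open>\<open>{x, y}\<close> is meant as the edge inside \<open>V\<close>, \<open>a\<close> as
  the outer vertex completing a triangle and \<open>{a, a'}\<close> as the pendant edge. The flags
  are there because not every residue labels an outer vertex.\<close>

definition tri_block :: "'a \<Rightarrow> 'a \<Rightarrow> bool \<Rightarrow> 'a \<Rightarrow> bool \<Rightarrow> 'a \<Rightarrow> 'a set set" where
  "tri_block x y c a b a' =
     {{x, y}} \<union> (if c then {{x, a}, {y, a}} else {}) \<union> (if b then {{a, a'}} else {})"

definition tri_verts :: "'a \<Rightarrow> 'a \<Rightarrow> bool \<Rightarrow> 'a \<Rightarrow> bool \<Rightarrow> 'a \<Rightarrow> 'a set" where
  "tri_verts x y c a b a' = {x, y} \<union> (if c then {a} else {}) \<union> (if b then {a'} else {})"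

text \<open>With both flags set this is the 4-cycle \<open>x\<close>, \<open>a\<close>,
  \<open>a'\<close>, \<open>y\<close>; with one flag, a path of two edges.\<close>

definition quad_block :: "'a \<Rightarrow> 'a \<Rightarrow> bool \<Rightarrow> 'a \<Rightarrow> bool \<Rightarrow> 'a \<Rightarrow> 'a set set" where
  "quad_block x y c a b a' =
     {{x, y}} \<union> (if c then {{x, a}} else {}) \<union> (if b then {{y, a'}} else {}) \<union>
     (if c \<and> b then {{a, a'}} else {})"

lemma card_tri_verts: "card (tri_verts x y c a b a') \<le> 2 + of_bool c + of_bool b"
  by (auto simp: tri_verts_def card_insert_if)

text \<open>The pendant edge contains \<open>a\<close>, which \<open>tri_verts\<close> lists only
  under \<open>c\<close>. The premise holds in the constructions because a pair in \<open>T\<close>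
  has its first entry in \<open>S\<close>.\<close>

lemma Union_tri_block: "(b \<Longrightarrow> c) \<Longrightarrow> \<Union>(tri_block x y c a b a') \<subseteq> tri_verts x y c a b a'"
  by (auto simp: tri_block_def tri_verts_def)

lemma Union_quad_block: "\<Union>(quad_block x y c a b a') \<subseteq> tri_verts x y c a b a'"
  by (auto simp: quad_block_def tri_verts_def)

lemma finite_blocks [simp]:
  "finite (tri_block x y c a b a')" "finite (quad_block x y c a b a')" "finite (tri_verts x y c a b a')"
  by (auto simp: tri_block_def quad_block_def tri_verts_def)

lemma card_blocks_le:
  "card (tri_block x y c a b a') \<le> 4" "card (quad_block x y c a b a') \<le> 4"
  by (auto simp: tri_block_def quad_block_def card_insert_if)

lemma card_inner_edges_le:
  assumes "c \<Longrightarrow> a \<notin> V" "b \<Longrightarrow> a' \<notin> V"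
  shows "card {e \<in> tri_block x y c a b a'. e \<subseteq> V} \<le> 1"
    and "card {e \<in> quad_block x y c a b a'. e \<subseteq> V} \<le> 1"
proof -
  have "{e \<in> tri_block x y c a b a'. e \<subseteq> V} \<subseteq> {{x, y}}"
    "{e \<in> quad_block x y c a b a'. e \<subseteq> V} \<subseteq> {{x, y}}"
    using assms by (auto simp: tri_block_def quad_block_def split: if_splits)
  from this[THEN card_mono[rotated]] show "card {e \<in> tri_block x y c a b a'. e \<subseteq> V} \<le> 1"
    "card {e \<in> quad_block x y c a b a'. e \<subseteq> V} \<le> 1"
    by simp_all
qed

text \<open>By symmetry of \<open>T\<close>, an outer edge may be read in the direction in which its
  second end is a short step ahead of the first; there it is a pendant edge.\<close>

lemma short_pair_cases:
  fixes T :: "(int \<times> int) set"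
  assumes "u = 2 * int h + 1" "T \<subseteq> {0..<u} \<times> {0..<u}" "sym T" "irrefl T" "(a, b) \<in> T"
  obtains d a' b' where "d \<in> {1..int h}" "(a', b') \<in> T" "{a', b'} = {a, b}" "b' = (a' + d) mod u"
proof -
  have "a \<in> {0..<u}" "b \<in> {0..<u}" "a \<noteq> b"
    using assms by (auto simp: irrefl_def)
  then obtain d where "d \<in> {1..int h}" "a = (b + d) mod u \<or> b = (a + d) mod u"
    using ex_mod_diff[OF assms(1), of a b] by metis
  moreover have "(b, a) \<in> T"
    using assms(3,5) by (auto simp: sym_def)
  ultimately show ?thesis
    using that assms(5) by (metis insert_commute)
qed


section \<open>Construction for even \<open>v\<close>\<close>

text \<open>The blocks pay 2 for each edge inside \<open>V\<close>, \<open>h + 1\<close> for each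
  outer vertex as an apex and 1 for each outer edge. This meets the lower bound, as half of the
  \<open>v * w\<close> cross edges is \<open>w * (h + 1)\<close>.\<close>

lemma ex_efficient_grooming_even:
  fixes X V :: "'a set"
  assumes "finite X" "V \<subseteq> X" and v: "card V = 2 * h + 2" and w: "card (X - V) \<le> 2 * h + 1"
  obtains P where "grooming X V 4 1 P" "card P \<le> card V choose 2"
    "cost P + card V * card (X - V) div 2 \<le> (card X choose 2) + (card V choose 2)"
proof -
  define u where "u = 2 * int h + 1"
  define w where "w = card (X - V)"
  \<comment> \<open>The choice of residues is arbitrary here; \<open>w\<close> is at most
    \<open>u\<close>, so there is room.\<close>
  define S where "S = {0..<int w}"
  have S: "S \<subseteq> {0..<u}"
    using w by (auto simp: S_def u_def w_def)
  have finV: "finite V"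
    using assms finite_subset by blast
  obtain z where z: "z \<in> V"
    using v by fastforce
  have "card {0..<u} = card (V - {z})"
    using v z finV by (simp add: u_def)
  then obtain p where p: "bij_betw p {0..<u} (V - {z})"
    using finite_same_card_bij[of "{0..<u}" "V - {z}"] finV by auto
  have "card S = card (X - V)"
    by (simp add: S_def w_def)
  then obtain q where q: "bij_betw q S (X - V)"
    using finite_same_card_bij[of S "X - V"] assms(1) by (auto simp: S_def)
  have q_notin: "q a \<notin> V" if "a \<in> S" for a
    using q that by (auto simp: bij_betw_def)
  define T where "T = S \<times> S - Id_on S"
  have T: "T \<subseteq> {0..<u} \<times> {0..<u}" "sym T" "irrefl T"
    using S by (auto simp: T_def sym_def irrefl_def)
  have cT: "card T + w = w * w"
  proof -
    have "Id_on S = (\<lambda>a. (a, a)) ` S"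
      by auto
    then have "card (Id_on S) = w"
      by (simp add: card_image inj_on_def S_def)
    moreover have "card (S \<times> S) = w * w" "Id_on S \<subseteq> S \<times> S" "finite (S \<times> S)"
      by (auto simp: S_def card_cartesian_product)
    ultimately show ?thesis
      unfolding T_def by (metis card_Diff_subset card_mono finite_subset le_add_diff_inverse2)
  qed
  \<comment> \<open>For \<open>d = 0\<close> the ends \<open>a + d\<close> and \<open>a - d\<close>
    coincide, and the extra point \<open>z\<close> replaces the second one.\<close>
  define y where "y a d = (if d = 0 then z else p ((a - d) mod u))" for a d :: int
  define B where "B = (\<lambda>(a, d). tri_block (p ((a + d) mod u)) (y a d) (a \<in> S) (q a)
      ((a, (a + d) mod u) \<in> T) (q ((a + d) mod u)))"
  define U where "U = (\<lambda>(a, d). tri_verts (p ((a + d) mod u)) (y a d) (a \<in> S) (q a)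
      ((a, (a + d) mod u) \<in> T) (q ((a + d) mod u)))"
  define I where "I = {0..<u} \<times> {0..int h}"
  \<comment> \<open>Index \<open>(a, 0)\<close> covers the edges among \<open>p a\<close>,
    \<open>z\<close> and \<open>q a\<close>. An edge of \<open>V\<close> without \<open>z\<close>
    lies in a block of its midpoint, an edge from \<open>p x\<close> to \<open>q a\<close> with
    \<open>x\<close> different from \<open>a\<close> in a block with apex \<open>q a\<close>, and an
    outer edge is pendant.\<close>
  have cover: "\<exists>i\<in>I. e \<in> B i" if edge: "e \<in> complete_edges X" for e
  proof -
    have star: "\<exists>i\<in>I. {p x, z} \<in> B i" if "x \<in> {0..<u}" for x
      using that by (intro bexI[of _ "(x, 0)"]) (auto simp: B_def I_def tri_block_def y_def)
    have zq: "\<exists>i\<in>I. {z, q x} \<in> B i" if "x \<in> S" for x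
      using that S by (intro bexI[of _ "(x, 0)"]) (auto simp: B_def I_def tri_block_def y_def)
    have pp: "\<exists>i\<in>I. {p x, p x'} \<in> B i" if xx': "x \<in> {0..<u}" "x' \<in> {0..<u}" "x \<noteq> x'" for x x'
    proof -
      obtain a d where ad: "a \<in> {0..<u}" "d \<in> {1..int h}"
        "{(a + d) mod u, (a - d) mod u} = {x, x'}"
        using ex_midpoint[OF u_def xx'] .
      have "{p ((a + d) mod u), p ((a - d) mod u)} = {p x, p x'}"
        using ad(3) by (metis image_empty image_insert)
      then show ?thesis
        using ad(1,2) by (intro bexI[of _ "(a, d)"]) (auto simp: B_def I_def tri_block_def y_def)
    qed
    have pq: "\<exists>i\<in>I. {p x, q a} \<in> B i" if xa: "x \<in> {0..<u}" "a \<in> S" for x a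
    proof (cases "x = a")
      case True
      then show ?thesis
        using that by (intro bexI[of _ "(x, 0)"]) (auto simp: B_def I_def tri_block_def y_def)
    next
      case False
      have "a \<in> {0..<u}"
        using that S by auto
      then obtain d where "d \<in> {1..int h}" "x = (a + d) mod u \<or> x = (a - d) mod u"
        using ex_mod_diff[OF u_def xa(1) _ False] by metis
      then show ?thesis
        using that S by (intro bexI[of _ "(a, d)"]) (auto simp: B_def I_def tri_block_def y_def)
    qed
    have qq: "\<exists>i\<in>I. {q a, q b} \<in> B i" if "a \<in> S" "b \<in> S" "a \<noteq> b" for a b
    proof -
      have "(a, b) \<in> T"
        using that by (auto simp: T_def)
      then obtain d a' b' where *: "d \<in> {1..int h}" "(a', b') \<in> T" "{a', b'} = {a, b}" "b' = (a' + d) mod u"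
        using short_pair_cases[OF u_def T] by metis
      have "{q a', q b'} = {q a, q b}"
        using *(3) by (metis image_empty image_insert)
      moreover have "a' \<in> {0..<u}"
        using *(2) T(1) by blast
      ultimately show ?thesis
        using *(1,2,4) by (intro bexI[of _ "(a', d)"]) (auto simp: B_def I_def tri_block_def)
    qed
    obtain r s where e: "e = {r, s}" "r \<noteq> s" "r \<in> X" "s \<in> X"
      using edge by (rule complete_edgesE)
    have cases: "t = z \<or> (\<exists>x\<in>{0..<u}. t = p x) \<or> (\<exists>a\<in>S. t = q a)" if "t \<in> X" for t
      using that bij_betw_imp_surj_on[OF p] bij_betw_imp_surj_on[OF q] by blast
    have swap: "\<exists>i\<in>I. {t', t} \<in> B i" if "\<exists>i\<in>I. {t, t'} \<in> B i" for t t'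
      using that by (simp add: insert_commute)
    from cases[OF e(3)] cases[OF e(4)] show ?thesis
      using e(2) unfolding e(1)
      by (elim disjE bexE) (auto intro!: star zq pp pq qq intro: star[THEN swap] zq[THEN swap] pq[THEN swap])
  qed
  have "finite I" and fin_card: "\<And>i. finite (B i)" "\<And>i. card (B i) \<le> 4" "\<And>i. finite (U i)"
    by (simp_all add: I_def B_def U_def card_blocks_le case_prod_unfold)
  have inner: "\<And>i. i \<in> I \<Longrightarrow> card {e \<in> B i. e \<subseteq> V} \<le> 1"
    using q_notin by (auto simp: B_def T_def intro!: card_inner_edges_le[unfolded One_nat_def])
  have verts: "\<Union>(B i) \<subseteq> U i" for i
    unfolding B_def U_def case_prod_unfold by (rule Union_tri_block) (auto simp: T_def)
  have "complete_edges X \<subseteq> (\<Union>i\<in>I. B i)"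
    using cover by blast
  then obtain P where P: "grooming X V 4 1 P" "card P \<le> card I" "cost P \<le> (\<Sum>i\<in>I. card (U i))"
    using \<open>finite I\<close> inner fin_card verts
    by - (rule grooming_of_cover[where I = I and B = B and U = U and X = X and V = V])
  have "(\<Sum>i\<in>I. card (U i))
      \<le> (\<Sum>(a, d)\<in>{0..<u} \<times> {0..int h}. 2 + of_bool (a \<in> S) + of_bool ((a, (a + d) mod u) \<in> T))"
    unfolding I_def U_def case_prod_unfold by (rule sum_mono) (rule card_tri_verts)
  also have "\<dots> \<le> 2 * ((2 * h + 1) * (h + 1)) + w * (h + 1) + card T div 2"
    using sum_block_sizes_le[OF u_def T, of "{0..int h}" S] S
    by (simp add: S_def nat_add_distrib)
  finally have cost: "cost P \<le> 2 * ((2 * h + 1) * (h + 1)) + w * (h + 1) + card T div 2"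
    using P(3) by linarith
  \<comment> \<open>This is also \<open>card I\<close>: one index for each edge inside
    \<open>V\<close>.\<close>
  have v2: "card V choose 2 = (2 * h + 1) * (h + 1)"
    unfolding v choose_two by (simp add: algebra_simps)
  have "card T = w * (w - 1)"
    using cT by (simp add: diff_mult_distrib2)
  then have cT2: "card T div 2 = w choose 2"
    by (simp add: choose_two)
  have "card X = card V + w"
    using assms(1,2) by (simp add: w_def card_Diff_subset card_mono finV)
  then have "card X choose 2 = (card V choose 2) + (w choose 2) + (2 * h + 2) * w"
    using choose_two_add v by metis
  moreover have "card V * card (X - V) div 2 = w * (h + 1)"
    unfolding v w_def by (simp add: algebra_simps)
  moreover have "(2 * h + 2) * w = w * (h + 1) + w * (h + 1)"
    by (simp add: algebra_simps)
  ultimately have "cost P + card V * card (X - V) div 2 \<le> (card X choose 2) + (card V choose 2)"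
    using cost cT2 v2 by linarith
  moreover have "card P \<le> card V choose 2"
    using P(2) v2 by (simp add: I_def u_def card_cartesian_product nat_add_distrib nat_mult_distrib)
  ultimately show ?thesis
    using that P(1) by blast
qed

section \<open>Construction for odd \<open>v\<close>\<close>

text \<open>The blocks with midpoint 0 receive \<open>w\<close> additional outer vertices, while
  \<open>k'\<close> outer edges are no longer pendant. The net increase \<open>w - k'\<close> is
  \<open>w / 2\<close> rounded up, exactly what the lower bound asks for when \<open>v * w\<close>
  is odd or even.\<close>

lemma ex_efficient_grooming_odd:
  fixes X V :: "'a set"
  assumes "finite X" "V \<subseteq> X" and v: "card V = 2 * h + 1" and w: "card (X - V) \<le> 2 * h"
  obtains P where "grooming X V 4 1 P" "card P \<le> card V choose 2"
    "cost P + card V * card (X - V) div 2 \<le> (card X choose 2) + (card V choose 2)"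
proof -
  define u where "u = 2 * int h + 1"
  define w where "w = card (X - V)"
  define k' where "k' = w div 2"
  define k where "k = w - k'"
  have k: "k + k' = w" "k' \<le> k" "k \<le> h"
    using w by (simp_all add: k_def k'_def w_def)
  \<comment> \<open>The residues \<open>1..k\<close> and \<open>-k'..-1\<close>. Leaving out 0 frees
    the blocks with midpoint 0 for the 4-cycles.\<close>
  define S where "S = {1..int k} \<union> {u - int k'..<u}"
  have S: "S \<subseteq> {0..<u}" and S0: "0 \<notin> S"
    using k by (auto simp: S_def u_def)
  have finS: "finite S"
    by (simp add: S_def)
  have cS: "card S = w"
    unfolding S_def using k by (subst card_Un_disjoint) (auto simp: u_def)
  have S_low: "d \<in> S \<longleftrightarrow> d \<le> int k" and S_high: "u - d \<in> S \<longleftrightarrow> d \<le> int k'" if "d \<in> {1..int h}" for d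
    using that k by (auto simp: S_def u_def)
  have finV: "finite V"
    using assms finite_subset by blast
  have "card {0..<u} = card V"
    using v by (simp add: u_def nat_add_distrib nat_mult_distrib)
  then obtain p where p: "bij_betw p {0..<u} V"
    using finite_same_card_bij[of "{0..<u}" V] finV by auto
  obtain q where q: "bij_betw q S (X - V)"
    using finite_same_card_bij[of S "X - V"] assms(1) finS cS by (auto simp: w_def)
  have q_notin: "q a \<notin> V" if "a \<in> S" for a
    using q that by (auto simp: bij_betw_def)
  define T where "T = {(a, b) \<in> S \<times> S. a \<noteq> b \<and> a + b \<noteq> u}"
  have T: "T \<subseteq> {0..<u} \<times> {0..<u}" "sym T" "irrefl T"
    using S by (auto simp: T_def sym_def irrefl_def)
  have cT: "card T + w + 2 * k' \<le> w * w"
  proof -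
    \<comment> \<open>The symmetric part of \<open>S\<close>: for odd \<open>w\<close>,
      \<open>k\<close> exceeds \<open>k'\<close> by one and the residue \<open>k\<close> has no
      partner. The excluded pairs are the diagonal \<open>A\<close> and the opposite pairs
      \<open>A'\<close>, disjoint because \<open>u\<close> is odd.\<close>
    define S' where "S' = {1..int k'} \<union> {u - int k'..<u}"
    define A where "A = (\<lambda>a. (a, a)) ` S"
    define A' where "A' = (\<lambda>a. (a, u - a)) ` S'"
    have "finite T"
      using T(1) finite_subset by blast
    have "card A = w"
      using cS by (simp add: A_def card_image inj_on_def)
    have "card S' = 2 * k'"
      unfolding S'_def using k by (subst card_Un_disjoint) (auto simp: u_def)
    then have "card A' = 2 * k'"
      by (simp add: A'_def card_image inj_on_def)
    have "A \<inter> A' = {}"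
      by (auto simp: A_def A'_def u_def) presburger
    moreover have "T \<inter> (A \<union> A') = {}"
      by (auto simp: A_def A'_def T_def)
    ultimately have "card (T \<union> (A \<union> A')) = card T + (w + 2 * k')"
      using \<open>finite T\<close> finS \<open>card A = w\<close> \<open>card A' = 2 * k'\<close>
      by (simp add: card_Un_disjoint A_def A'_def S'_def)
    moreover have "T \<union> (A \<union> A') \<subseteq> S \<times> S"
      using k by (auto simp: T_def A_def A'_def S'_def S_def u_def)
    then have "card (T \<union> (A \<union> A')) \<le> w * w"
      using card_mono[of "S \<times> S"] finS cS by (metis card_cartesian_product finite_cartesian_product)
    ultimately show ?thesis
      by linarith
  qed
  define B where "B = (\<lambda>(a, d).
      if a = 0 then quad_block (p d) (p (u - d)) (d \<in> S) (q d) (u - d \<in> S) (q (u - d))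
      else tri_block (p ((a + d) mod u)) (p ((a - d) mod u)) (a \<in> S) (q a)
        ((a, (a + d) mod u) \<in> T) (q ((a + d) mod u)))"
  define U where "U = (\<lambda>(a, d).
      if a = 0 then tri_verts (p d) (p (u - d)) (d \<in> S) (q d) (u - d \<in> S) (q (u - d))
      else tri_verts (p ((a + d) mod u)) (p ((a - d) mod u)) (a \<in> S) (q a)
        ((a, (a + d) mod u) \<in> T) (q ((a + d) mod u)))"
  define I where "I = {0..<u} \<times> {1..int h}"
  have cover: "\<exists>i\<in>I. e \<in> B i" if edge: "e \<in> complete_edges X" for e
  proof -
    have quad: "\<exists>i\<in>I. g \<in> B i"
      if "d \<in> {1..int h}" "g \<in> quad_block (p d) (p (u - d)) (d \<in> S) (q d) (u - d \<in> S) (q (u - d))" for d g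
      using that by (intro bexI[of _ "(0, d)"]) (auto simp: B_def I_def u_def)
    have pp: "\<exists>i\<in>I. {p x, p x'} \<in> B i" if xx': "x \<in> {0..<u}" "x' \<in> {0..<u}" "x \<noteq> x'" for x x'
    proof -
      obtain a d where ad: "a \<in> {0..<u}" "d \<in> {1..int h}"
        "{(a + d) mod u, (a - d) mod u} = {x, x'}"
        using ex_midpoint[OF u_def xx'] .
      then have e: "{p ((a + d) mod u), p ((a - d) mod u)} = {p x, p x'}"
        by (metis image_empty image_insert)
      show ?thesis
      proof (cases "a = 0")
        case True
        \<comment> \<open>Around midpoint 0 the ends are the residues \<open>d\<close> and
          \<open>u - d\<close>.\<close>
        have "d mod u = d"
          using ad(2) by (simp add: u_def)
        moreover have "(- d) mod u = u - d"
          using ad(2) by (simp add: u_def zmod_zminus1_eq_if)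
        ultimately have "{p x, p x'} = {p d, p (u - d)}"
          using e True by simp
        then show ?thesis
          using ad(2) by (intro quad[of d]) (auto simp: quad_block_def)
      next
        case False
        then show ?thesis
          using ad e by (intro bexI[of _ "(a, d)"]) (auto simp: B_def I_def tri_block_def)
      qed
    qed
    \<comment> \<open>Hence every cross edge between equal residues lies in the block
      \<open>(0, d)\<close> for some \<open>d\<close> in \<open>1..h\<close>.\<close>
    have halves: "a \<in> {1..int h} \<or> u - a \<in> {1..int h}" if "a \<in> S" for a
      using that S S0 k by (auto simp: S_def u_def)
    have pq: "\<exists>i\<in>I. {p x, q a} \<in> B i" if xa: "x \<in> {0..<u}" "a \<in> S" for x a
    proof (cases "x = a")
      case True
      from halves[OF that(2)] show ?thesis
      proof
        assume "a \<in> {1..int h}"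
        then show ?thesis
          using that True by (intro quad[of a]) (auto simp: quad_block_def)
      next
        assume "u - a \<in> {1..int h}"
        then show ?thesis
          using that True by (intro quad[of "u - a"]) (auto simp: quad_block_def)
      qed
    next
      case False
      have "a \<in> {0..<u}" "a \<noteq> 0"
        using that S S0 by auto
      then obtain d where "d \<in> {1..int h}" "x = (a + d) mod u \<or> x = (a - d) mod u"
        using ex_mod_diff[OF u_def xa(1) _ False] by metis
      then show ?thesis
        using that S \<open>a \<noteq> 0\<close>
        by (intro bexI[of _ "(a, d)"]) (auto simp: B_def I_def tri_block_def)
    qed
    have qq: "\<exists>i\<in>I. {q a, q b} \<in> B i" if "a \<in> S" "b \<in> S" "a \<noteq> b" for a b
    proof (cases "a + b = u")
      case True
      then have "b = u - a"
        by simp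
      from halves[OF that(1)] show ?thesis
      proof
        assume "a \<in> {1..int h}"
        then show ?thesis
          using that \<open>b = u - a\<close> by (intro quad[of a]) (auto simp: quad_block_def)
      next
        assume "u - a \<in> {1..int h}"
        then show ?thesis
          using that \<open>b = u - a\<close> by (intro quad[of "u - a"]) (auto simp: quad_block_def)
      qed
    next
      case False
      then have "(a, b) \<in> T"
        using that by (auto simp: T_def)
      then obtain d a' b' where *: "d \<in> {1..int h}" "(a', b') \<in> T" "{a', b'} = {a, b}" "b' = (a' + d) mod u"
        using short_pair_cases[OF u_def T] by metis
      have "{q a', q b'} = {q a, q b}"
        using *(3) by (metis image_empty image_insert)
      moreover have "a' \<noteq> 0" "a' \<in> {0..<u}"
        using *(2) T(1) S0 by (auto simp: T_def)
      ultimately show ?thesis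
        using * by (intro bexI[of _ "(a', d)"]) (auto simp: B_def I_def tri_block_def)
    qed
    obtain r s where e: "e = {r, s}" "r \<noteq> s" "r \<in> X" "s \<in> X"
      using edge by (rule complete_edgesE)
    have cases: "(\<exists>x\<in>{0..<u}. t = p x) \<or> (\<exists>a\<in>S. t = q a)" if "t \<in> X" for t
      using that bij_betw_imp_surj_on[OF p] bij_betw_imp_surj_on[OF q] by blast
    have swap: "\<exists>i\<in>I. {t', t} \<in> B i" if "\<exists>i\<in>I. {t, t'} \<in> B i" for t t'
      using that by (simp add: insert_commute)
    from cases[OF e(3)] cases[OF e(4)] show ?thesis
      using e(2) unfolding e(1)
      by (elim disjE bexE) (auto intro!: pp pq qq intro: pq[THEN swap])
  qed
  have "finite I" and fin_card: "\<And>i. finite (B i)" "\<And>i. card (B i) \<le> 4" "\<And>i. finite (U i)"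
    by (simp_all add: I_def B_def U_def card_blocks_le case_prod_unfold)
  have inner: "\<And>i. i \<in> I \<Longrightarrow> card {e \<in> B i. e \<subseteq> V} \<le> 1"
    using q_notin by (auto simp: B_def T_def intro!: card_inner_edges_le[unfolded One_nat_def])
  have verts: "\<Union>(B i) \<subseteq> U i" for i
  proof (cases "fst i = 0")
    case True
    then show ?thesis
      unfolding B_def U_def case_prod_unfold by (simp add: Union_quad_block)
  next
    case False
    have "\<Union>(tri_block x y (a \<in> S) c ((a, b) \<in> T) d) \<subseteq> tri_verts x y (a \<in> S) c ((a, b) \<in> T) d" for x y a c b d
      by (rule Union_tri_block) (auto simp: T_def)
    then show ?thesis
      unfolding B_def U_def case_prod_unfold if_not_P[OF False] .
  qed
  have "complete_edges X \<subseteq> (\<Union>i\<in>I. B i)"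
    using cover by blast
  then obtain P where P: "grooming X V 4 1 P" "card P \<le> card I" "cost P \<le> (\<Sum>i\<in>I. card (U i))"
    using \<open>finite I\<close> inner fin_card verts
    by - (rule grooming_of_cover[where I = I and B = B and U = U and X = X and V = V])
  let ?f = "\<lambda>(a, d). 2 + of_bool (a \<in> S) + of_bool ((a, (a + d) mod u) \<in> T) :: nat"
  \<comment> \<open>The outer vertices of the blocks with midpoint 0. Summed over \<open>d\<close>,
    they run once through \<open>S\<close>: \<open>k\<close> low and \<open>k'\<close> high
    residues, \<open>w\<close> in all.\<close>
  let ?g = "\<lambda>(a :: int, d). if a = 0 then of_bool (d \<in> S) + of_bool (u - d \<in> S) else 0 :: nat"
  have "card (U i) \<le> ?f i + ?g i" for i
    by (cases i) (simp add: U_def order_trans[OF card_tri_verts])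
  then have "(\<Sum>i\<in>I. card (U i)) \<le> (\<Sum>i\<in>I. ?f i) + (\<Sum>i\<in>I. ?g i)"
    unfolding sum.distrib[symmetric] by (rule sum_mono)
  also have "(\<Sum>i\<in>I. ?g i) = (\<Sum>i\<in>{0} \<times> {1..int h}. ?g i)"
    by (rule sum.mono_neutral_right) (auto simp: I_def u_def split: if_splits)
  also have "\<dots> = (\<Sum>d\<in>{1..int h}. of_bool (d \<in> S) + of_bool (u - d \<in> S))"
    by (simp add: sum.cartesian_product[symmetric])
  also have "\<dots> = (\<Sum>d\<in>{1..int h}. of_bool (d \<le> int k) + of_bool (d \<le> int k'))"
    using S_low S_high by (intro sum.cong) auto
  also have "\<dots> = w"
  proof -
    have "{1..int h} \<inter> {d. d \<le> int k} = {1..int k}" "{1..int h} \<inter> {d. d \<le> int k'} = {1..int k'}"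
      using k by auto
    then show ?thesis
      using k(1) by (simp add: sum.distrib sum_of_bool_eq)
  qed
  also have "(\<Sum>i\<in>I. ?f i) \<le> 2 * ((2 * h + 1) * h) + w * h + card T div 2"
    using sum_block_sizes_le[OF u_def T, of "{1..int h}" S] S cS unfolding I_def by simp
  finally have cost: "cost P \<le> 2 * ((2 * h + 1) * h) + w * h + card T div 2 + w"
    using P(3) by linarith
  have v2: "card V choose 2 = (2 * h + 1) * h"
    unfolding v choose_two by (simp add: algebra_simps)
  have "card T + 2 * k' \<le> w * (w - 1)"
    using cT by (simp add: diff_mult_distrib2)
  \<comment> \<open>The \<open>k'\<close> outer edges inside 4-cycles are saved here; they offset
    the rounding in \<open>v * w div 2 = w * h + k'\<close>.\<close>
  then have cT2: "card T div 2 + k' \<le> w choose 2"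
    unfolding choose_two by linarith
  have "card X = card V + w"
    using assms(1,2) by (simp add: w_def card_Diff_subset card_mono finV)
  then have "card X choose 2 = (card V choose 2) + (w choose 2) + (2 * h + 1) * w"
    using choose_two_add v by metis
  moreover have "card V * card (X - V) div 2 = w * h + k'"
  proof -
    have "card V * card (X - V) = w + 2 * (w * h)"
      unfolding v w_def by (simp add: algebra_simps)
    then show ?thesis
      by (simp add: k'_def)
  qed
  moreover have "(2 * h + 1) * w = w * h + w * h + w"
    by (simp add: algebra_simps)
  ultimately have "cost P + card V * card (X - V) div 2 \<le> (card X choose 2) + (card V choose 2)"
    using cost cT2 v2 by linarith
  moreover have "card P \<le> card V choose 2"
    using P(2) v2 by (simp add: I_def u_def card_cartesian_product nat_add_distrib nat_mult_distrib)
  ultimately show ?thesis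
    using that P(1) by blast
qed

theorem theorem3p3:
  fixes X V :: "'a set" and v w :: nat
  assumes "finite X" and "V \<subseteq> X"
    and "card V = v" and "card X = v + w"
    and "v > w"
  shows "wavecost_MON X V 4 1 = v choose 2"
proof -
  have w: "card (X - V) = w"
    using assms by (simp add: card_Diff_subset finite_subset)
  \<comment> \<open>The wavelength bound has to be attained at minimum cost, so a single
    \<open>P\<close> must meet both bounds.\<close>
  obtain P where P: "grooming X V 4 1 P" "card P \<le> card V choose 2"
    "cost P + card V * card (X - V) div 2 \<le> (card X choose 2) + (card V choose 2)"
  proof (cases "even v")
    case True
    then obtain m where "v = 2 * m"
      by (rule evenE)
    \<comment> \<open>As \<open>v > w\<close> excludes \<open>v = 0\<close>, \<open>m\<close> is
      positive and \<open>h\<close> is \<open>m - 1\<close>.\<close>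
    then obtain h where "card V = 2 * h + 2"
      using assms(3,5) by (cases m) auto
    then show ?thesis
      using ex_efficient_grooming_even[OF assms(1,2), of h] that assms(3,5) w by auto
  next
    case False
    then obtain h where "card V = 2 * h + 1"
      using assms(3) by (metis oddE)
    then show ?thesis
      using ex_efficient_grooming_odd[OF assms(1,2), of h] that assms(3,5) w by auto
  qed
  have "ON X V 4 1 P"
    unfolding ON_def
  proof (intro conjI allI impI)
    fix Q assume "grooming X V 4 1 Q"
    from grooming_lower_bounds(2)[OF assms(1,2) this] show "cost P \<le> cost Q"
      using P(3) by linarith
  qed (rule P(1))
  moreover have "card P = v choose 2"
    using P(2) grooming_lower_bounds(1)[OF assms(1,2) P(1)] assms(3) by simp
  ultimately show ?thesis
    unfolding wavecost_MON_def
    by (intro Least_equality)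
      (use grooming_lower_bounds(1)[OF assms(1,2)] assms(3) in \<open>auto simp: ON_def\<close>)
qed

end
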